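(* (i) Let $\mathcal{H}$ be a complex Hilbert space, let $A\in\mathcal{B}(\mathcal{H})$ be a positive operator, and let $T\in\mathcal{B}_A(\mathcal{H})$. If $w_A(T)=\frac{\|T\|_A}{2}$, then $$\|\Re_A(T)\|_A=\|\Im_A(T)\|_A=\frac{\|T\|_A}{2}.$$ The converse is not necessarily true: there exist a complex Hilbert space $\mathcal{H}$, a positive operator $A\in\mathcal{B}(\mathcal{H})$ and $T\in\mathcal{B}_A(\mathcal{H})$ with $\|\Re_A(T)\|_A=\|\Im_A(T)\|_A=\frac{\|T\|_A}{2}$ but $w_A(T)\neq\frac{\|T\|_A}{2}$. (ii) Let $\mathcal{H}$ be a complex Hilbert space, let $A\in\mathcal{B}(\mathcal{H})$ be a positive operator, and let $T\in\mathcal{B}_A(\mathcal{H})$. Then $w_A(T)=\frac{\|T\|_A}{2}$ if and only if $$\|\Re_A(e^{\mathrm{i}\theta}T)\|_A=\|\Im_A(e^{\mathrm{i}\theta}T)\|_A=\frac{\|T\|_A}{2}\quad\text{for all }\theta\in\mathbb{R}.$$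
   Context: $\mathcal{B}(\mathcal{H})$ is the algebra of bounded linear operators on the complex Hilbert space $\mathcal{H}$ with inner product $\langle\cdot,\cdot\rangle$; $A\in\mathcal{B}(\mathcal{H})$ is positive (i.e. $\langle Ax,x\rangle\ge 0$ for all $x$), not necessarily injective. Put $\langle x,y\rangle_A=\langle Ax,y\rangle$ and $\|x\|_A=\sqrt{\langle x,x\rangle_A}$ (a seminorm on $\mathcal{H}$). $R(S)$ denotes the range of $S$ and $\overline{R(S)}$ its norm closure. $\mathcal{B}_A(\mathcal{H})=\{T\in\mathcal{B}(\mathcal{H}): R(T^*A)\subseteq R(A)\}$, equivalently the set of $T\in\mathcal{B}(\mathcal{H})$ for which there is $S\in\mathcal{B}(\mathcal{H})$ with $AS=T^*A$. For $T\in\mathcal{B}_A(\mathcal{H})$, $T^{\sharp_A}$ denotes the unique $X\in\mathcal{B}(\mathcal{H})$ with $AX=T^*A$ and $R(X)\subseteq\overline{R(A)}$. For $T\in\mathcal{B}_A(\mathcal{H})$: $\|T\|_A=\sup\{\|Tx\|_A: x\in\overline{R(A)},\ \|x\|_A=1\}=\sup\{\|Tx\|_A: x\in\mathcal{H},\ \|x\|_A=1\}$ (finite), and $w_A(T)=\sup\{|\langle Tx,x\rangle_A|: x\in\mathcal{H},\ \|x\|_A=1\}$. Finally $\Re_A(T)=\frac{T+T^{\sharp_A}}{2}$ and $\Im_A(T)=\frac{T-T^{\sharp_A}}{2\mathrm{i}}$. *)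

theory Defs
  imports "HOL-Analysis.Analysis"
begin

section \<open>Complex Hilbert spaces\<close>

text \<open>
  A complex inner product space is a real normed space carrying a complex scalar multiplication
  that extends the real one and an inner product that induces the norm. The inner product is
  linear in the first argument. The axiom \<open>cinner_self\<close> contains positive definiteness, since
  \<open>norm x = 0\<close> holds only for \<open>x = 0\<close>.
\<close>

class complex_inner = real_normed_vector +
  fixes scaleC :: "complex \<Rightarrow> 'a \<Rightarrow> 'a"  (infixr \<open>*\<^sub>C\<close> 75)
    and cinner :: "'a \<Rightarrow> 'a \<Rightarrow> complex"
  assumes scaleC_add_right: "a *\<^sub>C (x + y) = a *\<^sub>C x + a *\<^sub>C y"
    and scaleC_add_left: "(a + b) *\<^sub>C x = a *\<^sub>C x + b *\<^sub>C x"
    and scaleC_scaleC: "a *\<^sub>C b *\<^sub>C x = (a * b) *\<^sub>C x"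
    and scaleC_of_real: "complex_of_real r *\<^sub>C x = r *\<^sub>R x"
    and cinner_commute: "cinner x y = cnj (cinner y x)"
    and cinner_add_left: "cinner (x + y) z = cinner x z + cinner y z"
    and cinner_scaleC_left: "cinner (a *\<^sub>C x) y = a * cinner x y"
    and cinner_self: "cinner x x = complex_of_real ((norm x)\<^sup>2)"

class chilbert_space = complex_inner + complete_space

instantiation complex :: chilbert_space
begin

definition scaleC_complex :: "complex \<Rightarrow> complex \<Rightarrow> complex"
  where "scaleC_complex a x = a * x"

definition cinner_complex :: "complex \<Rightarrow> complex \<Rightarrow> complex"
  where "cinner_complex x y = x * cnj y"

instance
proof
  fix x :: complex
  show "cinner x x = complex_of_real ((norm x)\<^sup>2)"
    by (simp only: cinner_complex_def complex_norm_square)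
qed (auto simp: scaleC_complex_def cinner_complex_def algebra_simps scaleR_conv_of_real)

end

instantiation vec :: (chilbert_space, finite) chilbert_space
begin

definition scaleC_vec :: "complex \<Rightarrow> 'a ^ 'b \<Rightarrow> 'a ^ 'b"
  where "scaleC_vec a x = (\<chi> i. a *\<^sub>C (x $ i))"

definition cinner_vec :: "'a ^ 'b \<Rightarrow> 'a ^ 'b \<Rightarrow> complex"
  where "cinner_vec x y = (\<Sum>i\<in>UNIV. cinner (x $ i) (y $ i))"

instance
proof
  fix x y z :: "'a ^ 'b" and a b :: complex and r :: real
  show "a *\<^sub>C (x + y) = a *\<^sub>C x + a *\<^sub>C y"
    by (simp add: scaleC_vec_def vec_eq_iff scaleC_add_right)
  show "(a + b) *\<^sub>C x = a *\<^sub>C x + b *\<^sub>C x"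
    by (simp add: scaleC_vec_def vec_eq_iff scaleC_add_left)
  show "a *\<^sub>C b *\<^sub>C x = (a * b) *\<^sub>C x"
    by (simp add: scaleC_vec_def vec_eq_iff scaleC_scaleC)
  show "complex_of_real r *\<^sub>C x = r *\<^sub>R x"
    by (simp add: scaleC_vec_def vec_eq_iff scaleC_of_real)
  show "cinner x y = cnj (cinner y x)"
    unfolding cinner_vec_def cnj_sum by (rule sum.cong[OF refl cinner_commute])
  show "cinner (x + y) z = cinner x z + cinner y z"
    by (simp add: cinner_vec_def cinner_add_left sum.distrib)
  show "cinner (a *\<^sub>C x) y = a * cinner x y"
    by (simp add: cinner_vec_def scaleC_vec_def cinner_scaleC_left sum_distrib_left)
  show "cinner x x = complex_of_real ((norm x)\<^sup>2)"
    by (simp add: cinner_vec_def cinner_self norm_vec_def L2_set_def sum_nonneg)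
qed

end

section \<open>Operators and the semi-inner product of a positive operator\<close>

definition bounded_clinear :: "('a::chilbert_space \<Rightarrow> 'a) \<Rightarrow> bool"
  where "bounded_clinear T \<longleftrightarrow> bounded_linear T \<and> (\<forall>c x. T (c *\<^sub>C x) = c *\<^sub>C T x)"

definition cadjoint :: "('a::chilbert_space \<Rightarrow> 'a) \<Rightarrow> ('a \<Rightarrow> 'a)"
  where "cadjoint T =
    (THE S. bounded_clinear S \<and> (\<forall>x y. cinner (T x) y = cinner x (S y)))"

definition positive_op :: "('a::chilbert_space \<Rightarrow> 'a) \<Rightarrow> bool"
  where "positive_op A \<longleftrightarrow> bounded_clinear A \<and> (\<forall>x. cinner (A x) x \<in> \<real>\<^sub>\<ge>\<^sub>0)"

definition A_inner :: "('a::chilbert_space \<Rightarrow> 'a) \<Rightarrow> 'a \<Rightarrow> 'a \<Rightarrow> complex"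
  where "A_inner A x y = cinner (A x) y"

text \<open>For positive \<open>A\<close> the number \<open>A_inner A x x\<close> is real and nonnegative.\<close>

definition A_norm :: "('a::chilbert_space \<Rightarrow> 'a) \<Rightarrow> 'a \<Rightarrow> real"
  where "A_norm A x = sqrt (Re (A_inner A x x))"

definition B_A :: "('a::chilbert_space \<Rightarrow> 'a) \<Rightarrow> ('a \<Rightarrow> 'a) set"
  where "B_A A = {T. bounded_clinear T \<and> range (cadjoint T \<circ> A) \<subseteq> range A}"

definition A_adjoint :: "('a::chilbert_space \<Rightarrow> 'a) \<Rightarrow> ('a \<Rightarrow> 'a) \<Rightarrow> ('a \<Rightarrow> 'a)"
  where "A_adjoint A T =
    (THE X. bounded_clinear X \<and> A \<circ> X = cadjoint T \<circ> A \<and> range X \<subseteq> closure (range A))"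

text \<open>
  In the next two definitions the element \<open>0\<close> is inserted only to fix the supremum of the empty
  set as \<open>0\<close>: the set is empty iff \<open>A = 0\<close>, and all its elements are nonnegative. On \<^typ>\<open>real\<close>,
  \<open>Sup {}\<close> is not a meaningful value.
\<close>

definition A_opnorm :: "('a::chilbert_space \<Rightarrow> 'a) \<Rightarrow> ('a \<Rightarrow> 'a) \<Rightarrow> real"
  where "A_opnorm A T =
    Sup (insert 0 {A_norm A (T x) | x. x \<in> closure (range A) \<and> A_norm A x = 1})"

definition A_numerical_radius :: "('a::chilbert_space \<Rightarrow> 'a) \<Rightarrow> ('a \<Rightarrow> 'a) \<Rightarrow> real"
  where "A_numerical_radius A T =
    Sup (insert 0 {cmod (A_inner A (T x) x) | x. A_norm A x = 1})"

definition A_Re :: "('a::chilbert_space \<Rightarrow> 'a) \<Rightarrow> ('a \<Rightarrow> 'a) \<Rightarrow> ('a \<Rightarrow> 'a)"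
  where "A_Re A T = (\<lambda>x. (1 / 2) *\<^sub>C (T x + A_adjoint A T x))"

definition A_Im :: "('a::chilbert_space \<Rightarrow> 'a) \<Rightarrow> ('a \<Rightarrow> 'a) \<Rightarrow> ('a \<Rightarrow> 'a)"
  where "A_Im A T = (\<lambda>x. (1 / (2 * \<i>)) *\<^sub>C (T x - A_adjoint A T x))"

end

theory Submission
  imports Defs
begin

text \<open>
  An operator of \<open>B_A A\<close> is bounded for the seminorm of \<open>A\<close>, and \<open>A_Re A T\<close>, \<open>A_Im A T\<close> are symmetric
  for the semi-inner product, with quadratic forms \<open>Re \<langle>Tx, x\<rangle>\<^sub>A\<close> and \<open>Im \<langle>Tx, x\<rangle>\<^sub>A\<close>. By polarization the
  seminorm of a symmetric operator is at most its numerical radius, so both seminorms are at most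
  \<open>w\<^sub>A(T)\<close>, while \<open>T = A_Re A T + \<i> A_Im A T\<close> shows that their sum is at least that of \<open>T\<close>. If
  \<open>w\<^sub>A(T)\<close> is half the seminorm of \<open>T\<close>, both bounds must be equalities; the numerical radius and
  the seminorm do not change under \<open>T \<mapsto> e\<^sup>i\<^sup>\<theta> T\<close>. Conversely, rotating \<open>\<langle>Tx, x\<rangle>\<^sub>A\<close> onto the positive
  real axis bounds \<open>w\<^sub>A(T)\<close> by the seminorms of the real parts of the rotated operators.
\<close>

subsection \<open>Inner products\<close>

lemma cinner_zero_left [simp]: "cinner 0 y = 0"
  using cinner_add_left[of 0 0 y] by simp

lemma cinner_diff_left: "cinner (x - y) z = cinner x z - cinner y z"
  using cinner_add_left[of "x - y" y z] by simp

lemma cinner_add_right: "cinner x (y + z) = cinner x y + cinner x z"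
  by (metis cinner_add_left cinner_commute complex_cnj_add)

lemma cinner_scaleC_right: "cinner x (a *\<^sub>C y) = cnj a * cinner x y"
  by (metis cinner_commute cinner_scaleC_left complex_cnj_mult)

lemma cinner_zero_right [simp]: "cinner x 0 = 0"
  using cinner_add_right[of x 0 0] by simp

lemma cinner_diff_right: "cinner x (y - z) = cinner x y - cinner x z"
  using cinner_add_right[of x "y - z" z] by simp

lemma scaleC_one [simp]: "1 *\<^sub>C x = x"
  using scaleC_of_real[of 1 x] by simp

lemma scaleC_minus_one: "(- 1) *\<^sub>C x = - x"
  using scaleC_of_real[of "-1" x] by simp

lemma scaleC_diff_right: "a *\<^sub>C (x - y) = a *\<^sub>C x - a *\<^sub>C y"
  using scaleC_add_right[of a "x - y" y] by (simp add: algebra_simps)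

lemma norm_eq_cinner: "(norm x)\<^sup>2 = Re (cinner x x)"
  by (simp add: cinner_self)

lemma norm_scaleC: "norm (a *\<^sub>C x) = cmod a * norm x"
proof -
  have "cinner (a *\<^sub>C x) (a *\<^sub>C x) = (a * cnj a) * cinner x x"
    by (simp add: cinner_scaleC_left cinner_scaleC_right)
  also have "\<dots> = of_real ((cmod a * norm x)\<^sup>2)"
    by (simp add: cinner_self complex_norm_square[symmetric] power_mult_distrib del: of_real_power)
  finally have "(norm (a *\<^sub>C x))\<^sup>2 = (cmod a * norm x)\<^sup>2"
    by (metis cinner_self of_real_eq_iff)
  then show ?thesis by (simp add: power2_eq_iff_nonneg)
qed

lemma norm_diff_scaleC_sq:
  "(norm (x - a *\<^sub>C y))\<^sup>2 = (norm x)\<^sup>2 - 2 * Re (cnj a * cinner x y) + (cmod a)\<^sup>2 * (norm y)\<^sup>2"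
proof -
  have "cinner y x = cnj (cinner x y)" by (rule cinner_commute)
  then have "Re (a * cinner y x) = Re (cnj a * cinner x y)" by simp
  moreover have "(norm (x - a *\<^sub>C y))\<^sup>2
      = (norm x)\<^sup>2 - Re (cnj a * cinner x y) - Re (a * cinner y x) + (norm (a *\<^sub>C y))\<^sup>2"
    by (simp add: norm_eq_cinner cinner_diff_left cinner_diff_right cinner_scaleC_left
      cinner_scaleC_right algebra_simps)
  ultimately show ?thesis by (simp add: norm_scaleC power_mult_distrib)
qed

lemma parallelogram_law: "(norm (x + y))\<^sup>2 + (norm (x - y))\<^sup>2 = 2 * (norm x)\<^sup>2 + 2 * (norm y)\<^sup>2"
  for x y :: "'a::complex_inner"
  by (simp add: norm_eq_cinner cinner_add_left cinner_add_right cinner_diff_left cinner_diff_right)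

section \<open>Bounded complex-linear operators\<close>

lemma bounded_clinearI:
  assumes "\<And>x y. T (x + y) = T x + T y" "\<And>c x. T (c *\<^sub>C x) = c *\<^sub>C T x"
    and "\<And>x. norm (T x) \<le> K * norm x"
  shows "bounded_clinear T"
  unfolding bounded_clinear_def
proof (intro conjI allI)
  show "bounded_linear T"
  proof (rule bounded_linear_intro)
    fix r x show "T (r *\<^sub>R x) = r *\<^sub>R T x" using assms(2)[of "of_real r" x] by (simp add: scaleC_of_real)
  qed (use assms in \<open>auto simp: mult.commute\<close>)
qed (use assms in auto)

lemma bounded_clinear_id: "bounded_clinear (\<lambda>x. x)"
  by (rule bounded_clinearI[where K = 1]) auto

context
  fixes T :: "'a::chilbert_space \<Rightarrow> 'a"
  assumes T: "bounded_clinear T"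
begin

lemma bounded_clinear_bounded_linear: "bounded_linear T"
  using T by (simp add: bounded_clinear_def)

lemma bounded_clinear_scaleC: "T (c *\<^sub>C x) = c *\<^sub>C T x"
  using T by (simp add: bounded_clinear_def)

lemma bounded_clinear_add: "T (x + y) = T x + T y"
  using bounded_clinear_bounded_linear by (simp add: linear_simps)

lemma bounded_clinear_diff: "T (x - y) = T x - T y"
  using bounded_clinear_bounded_linear by (simp add: linear_simps)

lemma bounded_clinear_scaleC_left: "bounded_clinear (\<lambda>x. c *\<^sub>C T x)"
proof -
  obtain K where "\<And>x. norm (T x) \<le> K * norm x"
    using bounded_linear.bounded[OF bounded_clinear_bounded_linear] by (auto simp: mult.commute)
  then show ?thesis
    by (intro bounded_clinearI[where K = "cmod c * K"])
      (auto simp: bounded_clinear_add bounded_clinear_scaleC scaleC_add_right scaleC_scaleC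
        norm_scaleC mult_left_mono mult.assoc mult.commute[of c])
qed

end

lemma bounded_clinear_plus:
  assumes "bounded_clinear S" "bounded_clinear T"
  shows "bounded_clinear (\<lambda>x. S x + T x)"
  using assms unfolding bounded_clinear_def
  by (auto intro: bounded_linear_add simp: scaleC_add_right)

lemma bounded_clinear_compose:
  assumes "bounded_clinear S" "bounded_clinear T"
  shows "bounded_clinear (\<lambda>x. S (T x))"
  using assms unfolding bounded_clinear_def
  by (auto intro: bounded_linear_compose)

subsection \<open>The semi-inner product of a positive operator\<close>

locale positive_operator =
  fixes A :: "'a::chilbert_space \<Rightarrow> 'a"
  assumes positive: "positive_op A"
begin

lemma clinear_A: "bounded_clinear A"
  using positive by (simp add: positive_op_def)

lemma A_inner_simps:
  "A_inner A (x + y) z = A_inner A x z + A_inner A y z"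
  "A_inner A (x - y) z = A_inner A x z - A_inner A y z"
  "A_inner A (c *\<^sub>C x) z = c * A_inner A x z"
  "A_inner A x (y + z) = A_inner A x y + A_inner A x z"
  "A_inner A x (y - z) = A_inner A x y - A_inner A x z"
  "A_inner A x (c *\<^sub>C z) = cnj c * A_inner A x z"
  by (simp_all add: A_inner_def bounded_clinear_add[OF clinear_A] bounded_clinear_diff[OF clinear_A]
      bounded_clinear_scaleC[OF clinear_A] cinner_add_left cinner_add_right cinner_diff_left
      cinner_diff_right cinner_scaleC_left cinner_scaleC_right)

lemma A_inner_self_real: "Im (A_inner A x x) = 0"
  and A_inner_self_nonneg: "0 \<le> Re (A_inner A x x)"
  using positive by (auto simp: positive_op_def A_inner_def complex_nonneg_Reals_iff)

lemma A_inner_self: "A_inner A x x = of_real ((A_norm A x)\<^sup>2)"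
  by (simp add: complex_eq_iff A_norm_def A_inner_self_real A_inner_self_nonneg)

lemma A_norm_sq: "(A_norm A x)\<^sup>2 = Re (A_inner A x x)"
  by (simp add: A_norm_def A_inner_self_nonneg)

lemma A_norm_nonneg [simp]: "0 \<le> A_norm A x"
  by (simp add: A_norm_def A_inner_self_nonneg)

text \<open>Polarization with the scalars \<open>1\<close> and \<open>\<i>\<close>: over \<open>\<complex>\<close>, positivity forces self-adjointness.\<close>

lemma A_inner_commute: "A_inner A x y = cnj (A_inner A y x)"
proof (rule complex_eqI)
  show "Re (A_inner A x y) = Re (cnj (A_inner A y x))"
    using A_inner_self_real[of "x + \<i> *\<^sub>C y"] A_inner_self_real[of x] A_inner_self_real[of y]
    by (simp add: A_inner_simps)
  show "Im (A_inner A x y) = Im (cnj (A_inner A y x))"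
    using A_inner_self_real[of "x + y"] A_inner_self_real[of x] A_inner_self_real[of y]
    by (simp add: A_inner_simps)
qed

lemma cinner_A_right: "cinner x (A y) = A_inner A x y"
  by (metis A_inner_commute A_inner_def cinner_commute)

lemma A_norm_diff_scaleC_sq: "(A_norm A (x - c *\<^sub>C y))\<^sup>2
    = (A_norm A x)\<^sup>2 - 2 * Re (cnj c * A_inner A x y) + (cmod c)\<^sup>2 * (A_norm A y)\<^sup>2"
proof -
  have "A_inner A y x = cnj (A_inner A x y)" by (rule A_inner_commute)
  then have "Re (c * A_inner A y x) = Re (cnj c * A_inner A x y)" by simp
  moreover have "Re (c * (cnj c * A_inner A y y)) = (cmod c)\<^sup>2 * Re (A_inner A y y)"
    unfolding cmod_power2 by (simp add: A_inner_self_real algebra_simps power2_eq_square)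
  ultimately show ?thesis
    by (simp add: A_norm_sq A_inner_simps algebra_simps)
qed

text \<open>The squared seminorm of \<open>x - (t * a) *\<^sub>C y\<close> is a nonnegative real
  quadratic in \<open>t\<close>. Nonzero vectors can have seminorm zero, so such a \<open>y\<close>
  is a separate case, where the quadratic degenerates to a linear function of
  \<open>t\<close>.\<close>

lemma A_inner_Cauchy_Schwarz: "cmod (A_inner A x y) \<le> A_norm A x * A_norm A y"
proof -
  define a where "a = A_inner A x y"
  have *: "0 \<le> (A_norm A x)\<^sup>2 - 2 * t * (cmod a)\<^sup>2 + t\<^sup>2 * (cmod a)\<^sup>2 * (A_norm A y)\<^sup>2" for t
  proof -
    have "Re (cnj (of_real t * a) * a) = t * (cmod a)\<^sup>2"
      unfolding cmod_power2 by (simp add: power2_eq_square algebra_simps)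
    moreover have "(cmod (of_real t * a))\<^sup>2 = t\<^sup>2 * (cmod a)\<^sup>2"
      by (simp add: norm_mult power_mult_distrib)
    ultimately show ?thesis
      using A_norm_diff_scaleC_sq[of x "of_real t * a" y, folded a_def]
        zero_le_power2[of "A_norm A (x - (of_real t * a) *\<^sub>C y)"]
      by (metis mult.assoc)
  qed
  show ?thesis
  proof (cases "A_norm A y = 0")
    case True
    have "a = 0"
    proof (rule ccontr)
      assume "a \<noteq> 0"
      \<comment> \<open>At this \<open>t\<close> the expression equals
        \<open>- (A_norm A x)\<^sup>2 - 2\<close>.\<close>
      then show False
        using *[of "((A_norm A x)\<^sup>2 + 1) / (cmod a)\<^sup>2"] True
        by (simp add: add_nonneg_pos) (use zero_le_power2[of "A_norm A x"] in linarith)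
    qed
    then show ?thesis by (simp add: a_def)
  next
    case False
    \<comment> \<open>The chosen \<open>t\<close> minimizes the quadratic.\<close>
    then have "0 \<le> (A_norm A x)\<^sup>2 - (cmod a)\<^sup>2 / (A_norm A y)\<^sup>2"
      using *[of "1 / (A_norm A y)\<^sup>2"] by (simp add: power2_eq_square)
    then have "(cmod a)\<^sup>2 \<le> (A_norm A x * A_norm A y)\<^sup>2"
      using False by (simp add: field_simps power_mult_distrib)
    then show ?thesis unfolding a_def by (rule power2_le_imp_le) simp
  qed
qed

lemma A_norm_scaleC: "A_norm A (c *\<^sub>C x) = cmod c * A_norm A x"
proof -
  have "Re (c * (cnj c * A_inner A x x)) = (cmod c)\<^sup>2 * Re (A_inner A x x)"
    unfolding cmod_power2 by (simp add: A_inner_self_real algebra_simps power2_eq_square)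
  moreover have "A_inner A (c *\<^sub>C x) (c *\<^sub>C x) = c * (cnj c * A_inner A x x)"
    by (simp add: A_inner_simps mult.left_commute)
  ultimately have "(A_norm A (c *\<^sub>C x))\<^sup>2 = (cmod c * A_norm A x)\<^sup>2"
    by (simp add: A_norm_sq power_mult_distrib)
  then show ?thesis by (simp add: power2_eq_iff_nonneg)
qed

lemma A_norm_add_le: "A_norm A (x + y) \<le> A_norm A x + A_norm A y"
proof (rule power2_le_imp_le)
  have "(A_norm A (x + y))\<^sup>2 = (A_norm A x)\<^sup>2 + 2 * Re (A_inner A x y) + (A_norm A y)\<^sup>2"
    using A_norm_diff_scaleC_sq[of x "-1" y] by (simp add: scaleC_minus_one)
  moreover have "Re (A_inner A x y) \<le> A_norm A x * A_norm A y"
    using A_inner_Cauchy_Schwarz complex_Re_le_cmod order_trans by blast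
  ultimately show "(A_norm A (x + y))\<^sup>2 \<le> (A_norm A x + A_norm A y)\<^sup>2"
    by (simp add: power2_sum)
qed simp

end

lemma positive_op_id: "positive_op (\<lambda>x. x)"
  by (simp add: positive_op_def bounded_clinear_id cinner_self complex_nonneg_Reals_iff)

lemma A_norm_id [simp]: "A_norm (\<lambda>x. x) = norm"
  by (simp add: fun_eq_iff A_norm_def A_inner_def norm_eq_cinner[symmetric])

text \<open>Instance of the semi-inner product inequality for the identity operator, whose seminorm
  is the norm.\<close>

lemma cinner_Cauchy_Schwarz: "cmod (cinner x y) \<le> norm x * norm y" for x :: "'a::chilbert_space"
proof -
  interpret positive_operator "\<lambda>x::'a. x" by standard (rule positive_op_id)
  show ?thesis using A_inner_Cauchy_Schwarz[of x y] by (simp add: A_inner_def)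
qed

subsection \<open>Orthogonal projection and adjoints\<close>

text \<open>Subtracting a small positive multiple of \<open>cinner u m *\<^sub>C m\<close> from
  \<open>u\<close> would otherwise shorten \<open>u\<close> to first order.\<close>

lemma minimal_distance_orthogonal:
  fixes u :: "'a::complex_inner"
  assumes "\<And>c. norm u \<le> norm (u - c *\<^sub>C m)"
  shows "cinner u m = 0"
proof (rule ccontr)
  define a where "a = cinner u m"
  \<comment> \<open>Small enough for the quadratic term to stay below the linear gain; the
    \<open>+ 1\<close> keeps the denominator positive for \<open>m = 0\<close>.\<close>
  define t where "t = 1 / ((norm m)\<^sup>2 + 1)"
  assume "cinner u m \<noteq> 0"
  then have a: "0 < (cmod a)\<^sup>2" by (simp add: a_def)
  have m: "0 < (norm m)\<^sup>2 + 1" by (simp add: add_nonneg_pos)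
  then have t: "0 < t" "t * (norm m)\<^sup>2 < 1" by (auto simp: t_def field_simps)
  have "(norm u)\<^sup>2 \<le> (norm (u - (of_real t * a) *\<^sub>C m))\<^sup>2"
    using assms by (intro power_mono) auto
  also have "\<dots> = (norm u)\<^sup>2 - 2 * (t * (cmod a)\<^sup>2) + t\<^sup>2 * (cmod a)\<^sup>2 * (norm m)\<^sup>2"
  proof -
    have "Re (cnj (of_real t * a) * a) = t * (cmod a)\<^sup>2"
      unfolding cmod_power2 by (simp add: power2_eq_square algebra_simps)
    moreover have "(cmod (of_real t * a))\<^sup>2 = t\<^sup>2 * (cmod a)\<^sup>2"
      by (simp add: norm_mult power_mult_distrib)
    ultimately show ?thesis unfolding norm_diff_scaleC_sq a_def[symmetric] by simp
  qed
  finally have "2 * (t * (cmod a)\<^sup>2) \<le> (t * (cmod a)\<^sup>2) * (t * (norm m)\<^sup>2)"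
    by (simp add: power2_eq_square algebra_simps)
  also have "\<dots> < (t * (cmod a)\<^sup>2) * 2"
    using t a by (intro mult_strict_left_mono) auto
  finally show False by simp
qed

text \<open>The parallelogram law makes a minimizing sequence for the distance from \<open>x\<close> to \<open>M\<close> Cauchy.\<close>

lemma orthogonal_projection:
  fixes M :: "'a::chilbert_space set"
  assumes M: "closed M" "M \<noteq> {}"
    and add: "\<And>x y. x \<in> M \<Longrightarrow> y \<in> M \<Longrightarrow> x + y \<in> M"
    and scale: "\<And>c x. x \<in> M \<Longrightarrow> c *\<^sub>C x \<in> M"
  obtains y where "y \<in> M" "\<And>m. m \<in> M \<Longrightarrow> cinner (x - y) m = 0"
proof -
  define d where "d = (INF m\<in>M. (norm (x - m))\<^sup>2)"
  have bdd: "bdd_below ((\<lambda>m. (norm (x - m))\<^sup>2) ` M)" by (rule bdd_belowI2[where m = 0]) simp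
  have d_le: "d \<le> (norm (x - m))\<^sup>2" if "m \<in> M" for m
    unfolding d_def by (rule cINF_lower[OF bdd that])
  have "\<exists>m\<in>M. (norm (x - m))\<^sup>2 < d + 1 / Suc k" for k
    using cINF_less_iff[OF M(2) bdd, of "d + 1 / Suc k"] by (simp add: d_def)
  then obtain m where m: "\<And>k. m k \<in> M" "\<And>k. (norm (x - m k))\<^sup>2 < d + 1 / Suc k" by metis
  have dist: "(norm (m k - m l))\<^sup>2 \<le> 2 / Suc k + 2 / Suc l" for k l
  proof -
    \<comment> \<open>The midpoint lies in \<open>M\<close>, so its squared distance to
      \<open>x\<close> is at least \<open>d\<close>; in the parallelogram law only the excesses
      \<open>1 / Suc k\<close> and \<open>1 / Suc l\<close> survive.\<close>
    define c where "c = (1/2::complex) *\<^sub>C (m k + m l)"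
    have "x - m k + (x - m l) = 2 *\<^sub>R (x - c)"
      by (simp add: c_def scaleC_of_real[symmetric] scaleC_diff_right scaleC_scaleC)
        (simp add: scaleC_of_real[of 2, simplified] scaleR_2)
    then have "(norm (x - m k + (x - m l)))\<^sup>2 = 4 * (norm (x - c))\<^sup>2"
      by (simp add: power_mult_distrib)
    moreover have "d \<le> (norm (x - c))\<^sup>2"
      unfolding c_def by (intro d_le scale add m)
    moreover have "norm (m k - m l) = norm (x - m k - (x - m l))" by (simp add: norm_minus_commute)
    ultimately show ?thesis
      using parallelogram_law[of "x - m k" "x - m l"] m(2)[of k] m(2)[of l] by simp
  qed
  have "Cauchy m"
  proof (rule CauchyI)
    fix e :: real assume "0 < e"
    then obtain N where N: "4 / e\<^sup>2 < real N" "0 < N"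
      by (metis gr0I less_irrefl of_nat_0 reals_Archimedean2 zero_less_divide_iff zero_less_numeral
        zero_less_power order_less_trans)
    have "norm (m k - m l) < e" if "k \<ge> N" "l \<ge> N" for k l
    proof (rule power2_less_imp_less)
      have "2 / real (Suc k) \<le> 2 / N" "2 / real (Suc l) \<le> 2 / N"
        using that N(2) by (auto intro!: divide_left_mono)
      then have "(norm (m k - m l))\<^sup>2 \<le> 4 / N" using dist[of k l] by simp
      also have "\<dots> < e\<^sup>2" using N \<open>0 < e\<close> by (simp add: field_simps)
      finally show "(norm (m k - m l))\<^sup>2 < e\<^sup>2" .
    qed (use \<open>0 < e\<close> in simp)
    then show "\<exists>N. \<forall>k\<ge>N. \<forall>l\<ge>N. norm (m k - m l) < e" by blast
  qed
  then obtain y where y: "m \<longlonglongrightarrow> y" using Cauchy_convergent convergent_def by blast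
  have "y \<in> M" using closed_sequentially[OF M(1)] m(1) y by blast
  have "(\<lambda>k. (norm (x - m k))\<^sup>2) \<longlonglongrightarrow> (norm (x - y))\<^sup>2" by (intro tendsto_intros y)
  moreover have "(\<lambda>k. d + 1 / Suc k) \<longlonglongrightarrow> d + 0"
    using LIMSEQ_inverse_real_of_nat by (intro tendsto_intros) (simp add: inverse_eq_divide)
  ultimately have "(norm (x - y))\<^sup>2 \<le> d + 0"
    by (rule LIMSEQ_le) (use m(2) less_imp_le in blast)
  then have min: "(norm (x - y))\<^sup>2 \<le> d" by simp
  show thesis
  proof (rule that[OF \<open>y \<in> M\<close>])
    fix n assume "n \<in> M"
    show "cinner (x - y) n = 0"
    proof (rule minimal_distance_orthogonal)
      fix c
      have "(norm (x - y))\<^sup>2 \<le> (norm (x - (y + c *\<^sub>C n)))\<^sup>2"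
        using min d_le[OF add[OF \<open>y \<in> M\<close> scale[OF \<open>n \<in> M\<close>]]] by (rule order_trans)
      then show "norm (x - y) \<le> norm (x - y - c *\<^sub>C n)"
        by (simp add: diff_diff_eq)
    qed
  qed
qed

text \<open>For nonzero \<open>f\<close>, projecting a point off the kernel leaves a residual
  \<open>u\<close> orthogonal to the kernel. Every \<open>v\<close> is a multiple of
  \<open>u\<close> plus a kernel element, so pairing with \<open>u\<close> recovers
  \<open>f v\<close>.\<close>

lemma Riesz_representation:
  fixes f :: "'a::chilbert_space \<Rightarrow> complex"
  assumes f: "bounded_linear f" and fC: "\<And>c x. f (c *\<^sub>C x) = c * f x"
  obtains z where "\<And>x. f x = cinner x z"
proof (cases "\<forall>x. f x = 0")
  case True
  then show thesis by (intro that[of 0]) simp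
next
  case False
  then obtain x0 where x0: "f x0 \<noteq> 0" by blast
  interpret bounded_linear f by (rule f)
  have "closed (f -` {0})"
    by (intro closed_vimage continuous_on) (auto intro: tendsto_ident_at)
  moreover have "f -` {0} \<noteq> {}" using zero by blast
  ultimately obtain y where y: "f y = 0" "\<And>m. f m = 0 \<Longrightarrow> cinner (x0 - y) m = 0"
    by (rule orthogonal_projection[of "f -` {0}" x0]) (auto simp: add fC)
  define u where "u = x0 - y"
  have fu: "f u \<noteq> 0" using x0 y(1) by (simp add: u_def diff)
  then have u: "norm u \<noteq> 0" by (auto simp: zero)
  have "f v = cinner v (cnj (f u / (of_real ((norm u)\<^sup>2))) *\<^sub>C u)" for v
  proof -
    have "f (v - (f v / f u) *\<^sub>C u) = 0" using fu by (simp add: diff fC)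
    then have "cinner u (v - (f v / f u) *\<^sub>C u) = 0" using y(2) by (simp add: u_def)
    then have "cinner (v - (f v / f u) *\<^sub>C u) u = 0" by (metis cinner_commute complex_cnj_zero)
    then have "cinner v u = f v / f u * of_real ((norm u)\<^sup>2)"
      by (simp add: cinner_diff_left cinner_scaleC_left cinner_self)
    then show ?thesis using fu u by (simp add: cinner_scaleC_right)
  qed
  then show thesis by (rule that)
qed

lemma cinner_right_eqI: "(\<And>x. cinner x y = cinner x z) \<Longrightarrow> y = z" for y z :: "'a::complex_inner"
  using cinner_self[of "y - z"] by (auto simp: cinner_diff_right)

lemma cinner_left_eqI: "(\<And>x. cinner y x = cinner z x) \<Longrightarrow> y = z" for y z :: "'a::complex_inner"
  by (metis cinner_commute cinner_right_eqI)

lemma bounded_linear_cinner_left: "bounded_linear (\<lambda>x. cinner x z)" for z :: "'a::chilbert_space"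
  by (rule bounded_linear_intro[where K = "norm z"])
    (auto simp: cinner_add_left cinner_Cauchy_Schwarz cinner_scaleC_left scaleR_conv_of_real
      scaleC_of_real[of _ "_::'a", symmetric])

text \<open>Gives the definite description in \<open>cadjoint\<close> its meaning. Riesz
  representation supplies \<open>S y\<close> for each \<open>y\<close>; Cauchy-Schwarz applied to
  \<open>cinner (T (S y)) y\<close>, the squared norm of \<open>S y\<close>, bounds
  \<open>S\<close>.\<close>

lemma cadjoint_exists:
  assumes T: "bounded_clinear T"
  shows "\<exists>!S. bounded_clinear S \<and> (\<forall>x y. cinner (T x) y = cinner x (S y))"
proof (rule ex_ex1I)
  have "\<exists>z. \<forall>x. cinner (T x) y = cinner x z" for y
  proof (rule Riesz_representation[of "\<lambda>x. cinner (T x) y"])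
    show "bounded_linear (\<lambda>x. cinner (T x) y)"
      by (rule bounded_linear_compose[OF bounded_linear_cinner_left bounded_clinear_bounded_linear[OF T]])
  qed (auto simp: bounded_clinear_scaleC[OF T] cinner_scaleC_left)
  then obtain S where S: "\<And>x y. cinner (T x) y = cinner x (S y)" by metis
  obtain K where K: "\<And>x. norm (T x) \<le> norm x * K"
    using bounded_linear.bounded[OF bounded_clinear_bounded_linear[OF T]] by auto
  have "bounded_clinear S"
  proof (rule bounded_clinearI)
    fix y show "norm (S y) \<le> K * norm y"
    proof (cases "norm (S y) = 0")
      case True
      then show ?thesis
        using order_trans[OF norm_ge_zero K[of y]] by (simp add: mult.commute)
    next
      case False
      have "(norm (S y))\<^sup>2 = cmod (cinner (T (S y)) y)"
        by (simp add: S cinner_self norm_power)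
      also have "\<dots> \<le> norm (S y) * K * norm y"
        using order_trans[OF cinner_Cauchy_Schwarz mult_right_mono[OF K norm_ge_zero]] .
      finally show ?thesis using False by (simp add: power2_eq_square)
    qed
  qed (rule cinner_right_eqI, simp add: S[symmetric] cinner_add_right cinner_scaleC_right)+
  then show "\<exists>S. bounded_clinear S \<and> (\<forall>x y. cinner (T x) y = cinner x (S y))" using S by blast
next
  fix S S'
  assume "bounded_clinear S \<and> (\<forall>x y. cinner (T x) y = cinner x (S y))"
    "bounded_clinear S' \<and> (\<forall>x y. cinner (T x) y = cinner x (S' y))"
  then show "S = S'" by (metis cinner_right_eqI ext)
qed

lemma cinner_cadjoint: "bounded_clinear T \<Longrightarrow> cinner (T x) y = cinner x (cadjoint T y)"
  using theI'[OF cadjoint_exists] unfolding cadjoint_def by blast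

context positive_operator
begin

subsection \<open>Existence of the adjoint for the semi-inner product\<close>

lemma range_add: "x \<in> range A \<Longrightarrow> y \<in> range A \<Longrightarrow> x + y \<in> range A"
  by (auto simp flip: bounded_clinear_add[OF clinear_A])

lemma range_scaleC: "x \<in> range A \<Longrightarrow> c *\<^sub>C x \<in> range A"
  by (auto simp flip: bounded_clinear_scaleC[OF clinear_A])

lemma closure_range_add:
  assumes "x \<in> closure (range A)" "y \<in> closure (range A)"
  shows "x + y \<in> closure (range A)"
proof -
  obtain f g where "\<And>n. f n \<in> range A" "f \<longlonglongrightarrow> x" "\<And>n. g n \<in> range A" "g \<longlonglongrightarrow> y"
    using assms by (auto simp: closure_sequential)
  then have "(\<lambda>n. f n + g n) \<longlonglongrightarrow> x + y" "\<And>n. f n + g n \<in> range A"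
    by (auto intro: tendsto_add simp: range_add)
  then show ?thesis unfolding closure_sequential by (intro exI[of _ "\<lambda>n. f n + g n"]) auto
qed

lemma closure_range_scaleC:
  assumes "x \<in> closure (range A)"
  shows "c *\<^sub>C x \<in> closure (range A)"
proof -
  have lin: "bounded_linear (\<lambda>x::'a. c *\<^sub>C x)"
    by (rule bounded_clinear_bounded_linear[OF bounded_clinear_scaleC_left[OF bounded_clinear_id]])
  obtain f where "\<And>n. f n \<in> range A" "f \<longlonglongrightarrow> x"
    using assms by (auto simp: closure_sequential)
  then have "(\<lambda>n. c *\<^sub>C f n) \<longlonglongrightarrow> c *\<^sub>C x" "\<And>n. c *\<^sub>C f n \<in> range A"
    by (auto intro: bounded_linear.tendsto[OF lin] simp: range_scaleC)
  then show ?thesis unfolding closure_sequential by (intro exI[of _ "\<lambda>n. c *\<^sub>C f n"]) auto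
qed

text \<open>The residual of the orthogonal projection of \<open>x\<close> is orthogonal to the range
  of the self-adjoint \<open>A\<close>, hence annihilated by \<open>A\<close>.\<close>

lemma closure_range_projection:
  obtains y where "y \<in> closure (range A)" "A y = A x"
proof -
  obtain y where y: "y \<in> closure (range A)" "\<And>m. m \<in> closure (range A) \<Longrightarrow> cinner (x - y) m = 0"
    by (rule orthogonal_projection[of "closure (range A)" x])
      (auto simp: closure_range_add closure_range_scaleC)
  have "cinner (A (x - y)) z = cinner 0 z" for z
    using y(2)[of "A z"] closure_subset[of "range A"]
    by (auto simp: cinner_A_right A_inner_def)
  then have "A (x - y) = 0" by (rule cinner_left_eqI)
  then show thesis using y(1) that by (simp add: bounded_clinear_diff[OF clinear_A])
qed

text \<open>The estimate extends from the range to its closure by continuity, and can then be tested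
  at \<open>y\<close> itself.\<close>

lemma norm_le_if_cinner_range_le:
  assumes "y \<in> closure (range A)" "0 \<le> K" "\<And>z. cmod (cinner (A z) y) \<le> K * norm (A z)"
  shows "norm y \<le> K"
proof -
  have "continuous_on UNIV (\<lambda>w. cinner w y)"
    by (rule linear_continuous_on[OF bounded_linear_cinner_left])
  then have "closed {w. cmod (cinner w y) \<le> K * norm w}"
    by (intro closed_Collect_le continuous_intros)
  then have "closure (range A) \<subseteq> {w. cmod (cinner w y) \<le> K * norm w}"
    using assms(3) by (intro closure_minimal) auto
  then have "(norm y)\<^sup>2 \<le> K * norm y"
    using assms(1) by (auto simp: cinner_self norm_power)
  then show ?thesis using assms(2) by (cases "norm y = 0") (auto simp: power2_eq_square)
qed

text \<open>The difference lies in the closed range and is orthogonal to the range, so the preceding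
  bound applies with \<open>K = 0\<close>. This is the source of uniqueness of
  \<open>A_adjoint\<close>.\<close>

lemma A_inj_closure_range:
  assumes "x \<in> closure (range A)" "y \<in> closure (range A)" "A x = A y"
  shows "x = y"
proof -
  have "x - y \<in> closure (range A)"
    using closure_range_add[OF assms(1) closure_range_scaleC[OF assms(2), of "-1"]]
    by (simp add: scaleC_minus_one)
  moreover have "cinner (A z) (x - y) = 0" for z
    using assms(3) cinner_A_right[of z "x - y"]
    by (simp add: bounded_clinear_diff[OF clinear_A] A_inner_def)
  ultimately have "norm (x - y) \<le> 0"
    by (intro norm_le_if_cinner_range_le) auto
  then show ?thesis by simp
qed

lemma A_inner_cadjoint:
  assumes "bounded_clinear T"
  shows "A_inner A (T x) y = cinner x (cadjoint T (A y))"
  using cinner_A_right[of "T x" y] cinner_cadjoint[OF assms] by simp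

lemma cadjoint_A_eq_iff:
  assumes "bounded_clinear T"
  shows "A z = cadjoint T (A y) \<longleftrightarrow> (\<forall>x. A_inner A (T x) y = A_inner A x z)"
proof -
  have "A z = w \<longleftrightarrow> (\<forall>x. cinner x w = A_inner A x z)" for w
    using cinner_right_eqI[of w "A z"] by (auto simp: cinner_A_right)
  then show ?thesis by (simp add: A_inner_cadjoint[OF assms])
qed

text \<open>The range inclusion read pointwise: a solution \<open>z\<close> for each
  \<open>y\<close> separately, with no linear or bounded dependence on \<open>y\<close> yet.
  Upgrading this to an operator is a form of Douglas' factorization theorem, proved in
  \<open>A_adjoint_exists\<close>.\<close>

lemma B_A_iff:
  "T \<in> B_A A \<longleftrightarrow> bounded_clinear T \<and> (\<forall>y. \<exists>z. \<forall>x. A_inner A (T x) y = A_inner A x z)"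
proof -
  have "range (cadjoint T \<circ> A) \<subseteq> range A \<longleftrightarrow> (\<forall>y. \<exists>z. A z = cadjoint T (A y))"
    unfolding image_subset_iff image_iff comp_def by (auto simp: eq_commute)
  then show ?thesis by (auto simp: B_A_def cadjoint_A_eq_iff)
qed

text \<open>
  The pointwise solution \<open>X\<close> of \<open>AX = T\<^sup>*A\<close> is bounded by Baire's theorem: since
  \<open>\<langle>Az, Xx\<rangle> = \<langle>ATz, x\<rangle>\<close>, each set \<open>{x. norm (X x) \<le> n}\<close> is closed, and these sets cover the space.
\<close>

lemma A_adjoint_exists:
  assumes T: "T \<in> B_A A"
  obtains X where "bounded_clinear X" "\<And>x y. A_inner A (T x) y = A_inner A x (X y)"
    "range X \<subseteq> closure (range A)"
proof -
  have "\<exists>z \<in> closure (range A). \<forall>x. A_inner A (T x) y = A_inner A x z" for y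
  proof -
    obtain z where "\<And>x. A_inner A (T x) y = A_inner A x z" using T B_A_iff by meson
    moreover obtain z' where "z' \<in> closure (range A)" "A z' = A z"
      using closure_range_projection by blast
    ultimately show ?thesis by (metis cinner_A_right)
  qed
  then obtain X where X: "\<And>y. X y \<in> closure (range A)"
    and adj: "\<And>x y. A_inner A (T x) y = A_inner A x (X y)" by metis
  \<comment> \<open>Solutions in the closed range are unique, so the pointwise choice
    \<open>X\<close> is automatically linear.\<close>
  have eqI: "X y = z" if "z \<in> closure (range A)" "\<And>x. A_inner A (T x) y = A_inner A x z" for y z
  proof (rule A_inj_closure_range[OF X that(1)])
    show "A (X y) = A z"
      by (rule cinner_right_eqI) (simp add: cinner_A_right that(2) flip: adj)
  qed
  have X_add: "X (x + y) = X x + X y" for x y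
    by (rule eqI) (simp_all add: X closure_range_add A_inner_simps adj)
  have X_scale: "X (c *\<^sub>C x) = c *\<^sub>C X x" for c x
    by (rule eqI) (simp_all add: X closure_range_scaleC A_inner_simps adj)
  have X_diff: "X (x - y) = X x - X y" for x y
    using X_add[of "x - y" y] by simp
  define E where "E n = {x. \<forall>z. cmod (cinner x (A (T z))) \<le> real n * norm (A z)}" for n
  have cinner_X: "cmod (cinner (A z) (X x)) = cmod (cinner x (A (T z)))" for x z
    using adj[of z x] by (metis A_inner_def cinner_commute complex_mod_cnj)
  have E_iff: "x \<in> E n \<longleftrightarrow> norm (X x) \<le> n" for x n
  proof
    assume "x \<in> E n"
    then show "norm (X x) \<le> n"
      by (intro norm_le_if_cinner_range_le X) (auto simp: E_def cinner_X)
  next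
    assume "norm (X x) \<le> n"
    then have "cmod (cinner (A z) (X x)) \<le> norm (A z) * real n" for z
      by (rule order_trans[OF cinner_Cauchy_Schwarz mult_left_mono]) simp
    then show "x \<in> E n"
      by (simp add: E_def cinner_X mult.commute)
  qed
  have E_closed: "closed (E n)" for n
    unfolding E_def
    by (intro closed_Collect_all closed_Collect_le continuous_intros
        linear_continuous_on[OF bounded_linear_cinner_left])
  have "\<exists>n. interior (E n) \<noteq> {}"
  proof (rule ccontr)
    assume "\<nexists>n. interior (E n) \<noteq> {}"
    then have "euclidean interior_of \<Union>(range E) = {}"
      using E_closed by (intro Baire_category_alt)
       (auto simp: completely_metrizable_space_euclidean)
    moreover have "x \<in> \<Union>(range E)" for x
      using real_nat_ceiling_ge[of "norm (X x)"] E_iff by blast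
    then have "\<Union>(range E) = UNIV" by blast
    ultimately show False by simp
  qed
  then obtain n x0 e where e: "0 < e" "ball x0 e \<subseteq> E n"
    by (metis equals0I mem_interior)
  have "norm (X x) \<le> 4 * real n / e * norm x" for x
  proof (cases "x = 0")
    case True
    then show ?thesis using X_diff[of 0 0] by simp
  next
    case False
    \<comment> \<open>Scales \<open>x\<close> to length \<open>e / 2\<close>, so that
      \<open>x0 + c x\<close> stays in the ball; the constant \<open>4 * n / e\<close> is
      \<open>2 * n\<close> divided by this scaling.\<close>
    define c where "c = e / (2 * norm x)"
    have c: "0 < c" using e(1) False by (simp add: c_def)
    have "x0 + of_real c *\<^sub>C x \<in> ball x0 e" "x0 \<in> ball x0 e"
      using e(1) False by (auto simp: dist_norm norm_scaleC norm_divide norm_mult c_def)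
    then have "norm (X (x0 + of_real c *\<^sub>C x)) \<le> n" "norm (X x0) \<le> n"
      using e(2) E_iff by blast+
    then have "norm (X (x0 + of_real c *\<^sub>C x) - X x0) \<le> 2 * n"
      using norm_triangle_ineq4[of "X (x0 + of_real c *\<^sub>C x)" "X x0"] by linarith
    then have "c * norm (X x) \<le> 2 * n"
      using c by (simp add: X_add X_scale norm_scaleC)
    then show ?thesis using e(1) False by (simp add: c_def field_simps)
  qed
  then have "bounded_clinear X" by (intro bounded_clinearI X_add X_scale)
  then show thesis using that X adj by blast
qed

text \<open>Evaluates the definite description in \<open>A_adjoint\<close>, both for the operator
  constructed above and for the concrete matrix at the end.\<close>

lemma A_adjoint_eqI:
  assumes "bounded_clinear T" "bounded_clinear X" "range X \<subseteq> closure (range A)"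
    and "\<And>x y. A_inner A (T x) y = A_inner A x (X y)"
  shows "A_adjoint A T = X"
  unfolding A_adjoint_def
proof (rule the_equality)
  have AX: "A (X y) = cadjoint T (A y)" for y
    using assms by (simp add: cadjoint_A_eq_iff)
  then show "bounded_clinear X \<and> A \<circ> X = cadjoint T \<circ> A \<and> range X \<subseteq> closure (range A)"
    using assms by auto
  fix Y
  assume "bounded_clinear Y \<and> A \<circ> Y = cadjoint T \<circ> A \<and> range Y \<subseteq> closure (range A)"
  then have "A (Y y) = A (X y)" "Y y \<in> closure (range A)" for y
    using AX by (auto simp: fun_eq_iff)
  then show "Y = X" using assms(3) A_inj_closure_range by blast
qed

lemma
  assumes "T \<in> B_A A"
  shows clinear_A_adjoint: "bounded_clinear (A_adjoint A T)"
    and A_inner_A_adjoint: "A_inner A (T x) y = A_inner A x (A_adjoint A T y)"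
proof -
  obtain X where X: "bounded_clinear X" "\<And>x y. A_inner A (T x) y = A_inner A x (X y)"
    "range X \<subseteq> closure (range A)"
    using A_adjoint_exists[OF assms] by metis
  moreover from this have "A_adjoint A T = X" using assms by (simp add: A_adjoint_eqI B_A_iff)
  ultimately show "bounded_clinear (A_adjoint A T)"
    "A_inner A (T x) y = A_inner A x (A_adjoint A T y)" by simp_all
qed

subsection \<open>Boundedness with respect to the seminorm\<close>

text \<open>This makes the suprema in \<open>A_opnorm\<close> and \<open>A_numerical_radius\<close>
  genuine: the sets are bounded above, and \<open>T\<close> sends null vectors of the seminorm to
  null vectors.\<close>

definition A_bounded :: "('a \<Rightarrow> 'a) \<Rightarrow> bool"
  where "A_bounded T \<longleftrightarrow> bounded_clinear T \<and> (\<exists>C. \<forall>x. A_norm A (T x) \<le> C * A_norm A x)"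

text \<open>
  Cauchy-Schwarz makes \<open>n \<mapsto> A_norm A (R\<^sup>n x)\<close> log-convex, while it grows at most like \<open>K\<^sup>n\<close> for a
  norm bound \<open>K\<close> of \<open>R\<close>; hence its first ratio is at most \<open>K\<close>. This avoids the square root of \<open>A\<close>.
\<close>

lemma A_symmetric_A_bounded:
  assumes R: "bounded_clinear R" and sym: "\<And>x y. A_inner A (R x) y = A_inner A x (R y)"
  shows "A_bounded R"
proof -
  obtain K where K: "0 < K" "\<And>x. norm (R x) \<le> norm x * K"
    using bounded_linear.pos_bounded[OF bounded_clinear_bounded_linear[OF R]] by blast
  obtain M where M: "0 < M" "\<And>x. norm (A x) \<le> norm x * M"
    using bounded_linear.pos_bounded[OF bounded_clinear_bounded_linear[OF clinear_A]] by blast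
  have "A_norm A (R x) \<le> K * A_norm A x" for x
  proof (rule ccontr)
    assume "\<not> ?thesis"
    then have less: "K * A_norm A x < A_norm A (R x)" by simp
    define a where "a n = A_norm A ((R ^^ n) x)" for n
    have convex: "(a (Suc n))\<^sup>2 \<le> a n * a (Suc (Suc n))" for n
    proof -
      have "(a (Suc n))\<^sup>2 = Re (A_inner A ((R ^^ n) x) ((R ^^ Suc (Suc n)) x))"
        by (simp add: a_def A_norm_sq sym)
      also have "\<dots> \<le> a n * a (Suc (Suc n))"
        unfolding a_def using order_trans[OF complex_Re_le_cmod A_inner_Cauchy_Schwarz] .
      finally show ?thesis .
    qed
    have "a 0 \<noteq> 0"
    proof
      assume "a 0 = 0"
      then have "a 1 = 0" using convex[of 0] by simp
      then show False using less \<open>a 0 = 0\<close> by (simp add: a_def)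
    qed
    then have a0: "0 < a 0" by (simp add: a_def order_less_le)
    define r where "r = a 1 / a 0"
    have r: "K < r" using less a0 by (simp add: r_def a_def field_simps)
    \<comment> \<open>By log-convexity the consecutive ratios never fall below the first one,
      \<open>r\<close>; positivity is carried along to permit cancelling
      \<open>a (Suc n)\<close>.\<close>
    have step: "0 < a n \<and> r * a n \<le> a (Suc n)" for n
    proof (induction n)
      case 0
      then show ?case using a0 by (simp add: r_def)
    next
      case (Suc n)
      then have pos: "0 < a (Suc n)"
        using mult_pos_pos[of r "a n"] r K(1) by linarith
      have "r * (a (Suc n))\<^sup>2 \<le> r * a n * a (Suc (Suc n))"
        using mult_left_mono[OF convex, of r n] r K(1) by (simp add: mult.assoc)
      also have "\<dots> \<le> a (Suc n) * a (Suc (Suc n))"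
        using Suc by (intro mult_right_mono) (auto simp: a_def)
      finally have "a (Suc n) * (r * a (Suc n)) \<le> a (Suc n) * a (Suc (Suc n))"
        by (simp add: power2_eq_square algebra_simps)
      then show ?case using pos by simp
    qed
    have lower: "r ^ n * a 0 \<le> a n" for n
    proof (induction n)
      case (Suc n)
      then have "r * (r ^ n * a 0) \<le> r * a n" using r K(1) by (intro mult_left_mono) auto
      then show ?case using step[of n] by simp
    qed simp
    have R_pow: "norm ((R ^^ n) x) \<le> K ^ n * norm x" for n
    proof (induction n)
      case (Suc n)
      have "norm ((R ^^ Suc n) x) \<le> norm ((R ^^ n) x) * K" using K(2) by simp
      also have "\<dots> \<le> K ^ n * norm x * K" using Suc K(1) by (intro mult_right_mono) auto
      finally show ?case by (simp add: mult.commute mult.left_commute)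
    qed simp
    have A_norm_le: "A_norm A y \<le> sqrt M * norm y" for y
    proof (rule power2_le_imp_le)
      have "(A_norm A y)\<^sup>2 \<le> norm (A y) * norm y"
        unfolding A_norm_sq A_inner_def
        using order_trans[OF complex_Re_le_cmod cinner_Cauchy_Schwarz] .
      also have "\<dots> \<le> norm y * M * norm y" by (intro mult_right_mono M) auto
      finally show "(A_norm A y)\<^sup>2 \<le> (sqrt M * norm y)\<^sup>2"
        using M(1) by (simp add: power_mult_distrib power2_eq_square[of "norm y"] mult.commute mult.left_commute)
    qed (use M(1) in simp)
    \<comment> \<open>Growth of at least \<open>r ^ n\<close> against at most \<open>K ^ n\<close>
      would keep the powers of \<open>r / K > 1\<close> bounded.\<close>
    have "(r / K) ^ n \<le> sqrt M * norm x / a 0" for n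
    proof -
      have "r ^ n * a 0 \<le> sqrt M * norm ((R ^^ n) x)"
        using lower[of n] A_norm_le[of "(R ^^ n) x"] by (simp add: a_def)
      also have "\<dots> \<le> sqrt M * (K ^ n * norm x)"
        using M(1) by (intro mult_left_mono R_pow) auto
      finally show ?thesis using K(1) a0 by (simp add: field_simps)
    qed
    moreover obtain n where "sqrt M * norm x / a 0 < (r / K) ^ n"
      using real_arch_pow[of "r / K"] r K(1) by auto
    ultimately show False by (meson not_le)
  qed
  then show ?thesis using R by (auto simp: A_bounded_def)
qed

lemma A_inner_adjoint_swap:
  assumes "\<And>x y. A_inner A (T x) y = A_inner A x (S y)"
  shows "A_inner A (S x) y = A_inner A x (T y)"
  by (metis A_inner_commute assms)

text \<open>The composition \<open>S T\<close> is symmetric, hence A-bounded, and the squared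
  seminorm of \<open>T x\<close> equals the semi-inner product of \<open>x\<close> with
  \<open>S (T x)\<close>. The sign of the bound \<open>C\<close> is unknown, hence its absolute
  value under the root.\<close>

lemma A_adjointable_A_bounded:
  assumes "bounded_clinear T" "bounded_clinear S"
    and adj: "\<And>x y. A_inner A (T x) y = A_inner A x (S y)"
  shows "A_bounded T"
proof -
  have "A_bounded (\<lambda>x. S (T x))"
    by (rule A_symmetric_A_bounded)
      (simp_all add: bounded_clinear_compose assms(1,2) A_inner_adjoint_swap[OF adj] adj)
  then obtain C where C: "\<And>x. A_norm A (S (T x)) \<le> C * A_norm A x"
    by (auto simp: A_bounded_def)
  have "A_norm A (T x) \<le> sqrt \<bar>C\<bar> * A_norm A x" for x
  proof (rule power2_le_imp_le)
    have "(A_norm A (T x))\<^sup>2 \<le> A_norm A x * A_norm A (S (T x))"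
      unfolding A_norm_sq adj
      using order_trans[OF complex_Re_le_cmod A_inner_Cauchy_Schwarz] .
    also have "\<dots> \<le> A_norm A x * (\<bar>C\<bar> * A_norm A x)"
      using C[of x] mult_right_mono[of C "\<bar>C\<bar>" "A_norm A x"]
      by (intro mult_left_mono) (auto intro: order_trans)
    finally show "(A_norm A (T x))\<^sup>2 \<le> (sqrt \<bar>C\<bar> * A_norm A x)\<^sup>2"
      by (simp add: power_mult_distrib power2_eq_square algebra_simps)
  qed simp
  then show ?thesis using assms(1) by (auto simp: A_bounded_def)
qed

lemma A_bounded_add:
  assumes "A_bounded S" "A_bounded T"
  shows "A_bounded (\<lambda>x. S x + T x)"
proof -
  obtain C D where "\<And>x. A_norm A (S x) \<le> C * A_norm A x" "\<And>x. A_norm A (T x) \<le> D * A_norm A x"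
    using assms by (auto simp: A_bounded_def)
  then have "A_norm A (S x + T x) \<le> (C + D) * A_norm A x" for x
    using A_norm_add_le[of "S x" "T x"] by (simp add: distrib_right) (meson add_mono order_trans)
  then show ?thesis using assms by (auto simp: A_bounded_def bounded_clinear_plus)
qed

lemma A_bounded_scaleC:
  assumes "A_bounded T"
  shows "A_bounded (\<lambda>x. c *\<^sub>C T x)"
proof -
  obtain C where "\<And>x. A_norm A (T x) \<le> C * A_norm A x"
    using assms by (auto simp: A_bounded_def)
  then have "A_norm A (c *\<^sub>C T x) \<le> (cmod c * C) * A_norm A x" for x
    by (simp add: A_norm_scaleC mult.assoc mult_left_mono)
  then show ?thesis using assms by (auto simp: A_bounded_def bounded_clinear_scaleC_left)
qed

subsection \<open>Operator seminorm and numerical radius\<close>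

text \<open>
  The supremum over the unit vectors in \<open>closure (range A)\<close> bounds all vectors: the projection onto
  that subspace changes neither \<open>A_norm A x\<close> nor, by A-boundedness, \<open>A_norm A (T x)\<close>.
\<close>

lemma A_opnorm_le_iff:
  assumes T: "A_bounded T"
  shows "A_opnorm A T \<le> C \<longleftrightarrow> 0 \<le> C \<and> (\<forall>x. A_norm A (T x) \<le> C * A_norm A x)"
proof
  define S where "S = insert 0 {A_norm A (T x) | x. x \<in> closure (range A) \<and> A_norm A x = 1}"
  have S: "A_opnorm A T = Sup S" by (simp add: A_opnorm_def S_def)
  obtain C0 where C0: "\<And>x. A_norm A (T x) \<le> C0 * A_norm A x"
    using T by (auto simp: A_bounded_def)
  have null: "A_norm A (T x) = 0" if "A_norm A x = 0" for x
    using C0[of x] that A_norm_nonneg[of "T x"] by simp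
  have "s \<le> max 0 C0" if "s \<in> S" for s
    using that C0 by (auto simp: S_def) (metis max.coboundedI2 mult.right_neutral)
  then have bdd: "bdd_above S" by (rule bdd_aboveI)
  show "0 \<le> C \<and> (\<forall>x. A_norm A (T x) \<le> C * A_norm A x)" if "A_opnorm A T \<le> C"
  proof (intro conjI allI)
    have upper: "s \<le> C" if "s \<in> S" for s
      using cSup_upper[OF that bdd] \<open>A_opnorm A T \<le> C\<close> S by simp
    \<comment> \<open>The inserted \<open>0\<close> belongs to \<open>S\<close> even if there are no
      unit vectors.\<close>
    show C: "0 \<le> C" by (rule upper) (simp add: S_def)
    fix x
    obtain y where y: "y \<in> closure (range A)" "A y = A x" by (rule closure_range_projection)
    have d0: "A_norm A (x - y) = 0" "A_norm A (y - x) = 0"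
      using y(2) by (simp_all add: A_norm_def A_inner_def bounded_clinear_diff[OF clinear_A])
    have "A_norm A (T x) \<le> A_norm A (T y) + A_norm A (T (x - y))"
      using A_norm_add_le[of "T y" "T (x - y)"] T
      by (simp add: A_bounded_def bounded_clinear_diff)
    then have Tx: "A_norm A (T x) \<le> A_norm A (T y)" using null[OF d0(1)] by simp
    have nx: "A_norm A y \<le> A_norm A x" using A_norm_add_le[of x "y - x"] d0 by simp
    have "A_norm A (T y) \<le> C * A_norm A y"
    proof (cases "A_norm A y = 0")
      case True
      then show ?thesis using null by simp
    next
      case False
      define c where "c = complex_of_real (1 / A_norm A y)"
      have "cmod c = 1 / A_norm A y" by (simp add: c_def norm_divide)
      then have "A_norm A (c *\<^sub>C y) = 1" "A_norm A (T (c *\<^sub>C y)) = A_norm A (T y) / A_norm A y"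
        using False T by (simp_all add: A_norm_scaleC A_bounded_def bounded_clinear_scaleC)
      then have "A_norm A (T y) / A_norm A y \<in> S"
        unfolding S_def using closure_range_scaleC[OF y(1), of c] by force
      from upper[OF this] show ?thesis
        using False by (simp add: divide_le_eq order_less_le)
    qed
    then show "A_norm A (T x) \<le> C * A_norm A x"
      using Tx mult_left_mono[OF nx C] by linarith
  qed
  show "A_opnorm A T \<le> C" if "0 \<le> C \<and> (\<forall>x. A_norm A (T x) \<le> C * A_norm A x)"
    unfolding S using that
    by (intro cSup_least) (auto simp: S_def, metis mult.right_neutral)
qed

text \<open>Rescaling to unit vectors, now with homogeneity of degree two; on null vectors both
  sides vanish by Cauchy-Schwarz.\<close>

lemma A_numerical_radius_le_iff:
  assumes T: "A_bounded T"
  shows "A_numerical_radius A T \<le> C \<longleftrightarrow>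
    0 \<le> C \<and> (\<forall>x. cmod (A_inner A (T x) x) \<le> C * (A_norm A x)\<^sup>2)"
proof
  define S where "S = insert 0 {cmod (A_inner A (T x) x) | x. A_norm A x = 1}"
  have S: "A_numerical_radius A T = Sup S" by (simp add: A_numerical_radius_def S_def)
  obtain C0 where C0: "\<And>x. A_norm A (T x) \<le> C0 * A_norm A x"
    using T by (auto simp: A_bounded_def)
  have "s \<le> max 0 C0" if "s \<in> S" for s
  proof (cases "s = 0")
    case False
    then obtain x where "s = cmod (A_inner A (T x) x)" "A_norm A x = 1"
      using \<open>s \<in> S\<close> by (auto simp: S_def)
    then show ?thesis using A_inner_Cauchy_Schwarz[of "T x" x] C0[of x] by simp
  qed simp
  then have bdd: "bdd_above S" by (rule bdd_aboveI)
  show "0 \<le> C \<and> (\<forall>x. cmod (A_inner A (T x) x) \<le> C * (A_norm A x)\<^sup>2)"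
    if "A_numerical_radius A T \<le> C"
  proof (intro conjI allI)
    have upper: "s \<le> C" if "s \<in> S" for s
      using cSup_upper[OF that bdd] \<open>A_numerical_radius A T \<le> C\<close> S by simp
    show "0 \<le> C" by (rule upper) (simp add: S_def)
    fix x
    show "cmod (A_inner A (T x) x) \<le> C * (A_norm A x)\<^sup>2"
    proof (cases "A_norm A x = 0")
      case True
      then show ?thesis using A_inner_Cauchy_Schwarz[of "T x" x] by simp
    next
      case False
      define c where "c = complex_of_real (1 / A_norm A x)"
      have "cmod c = 1 / A_norm A x" by (simp add: c_def norm_divide)
      then have "A_norm A (c *\<^sub>C x) = 1"
        "cmod (A_inner A (T (c *\<^sub>C x)) (c *\<^sub>C x)) = cmod (A_inner A (T x) x) / (A_norm A x)\<^sup>2"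
        using False T
        by (simp_all add: A_norm_scaleC A_bounded_def bounded_clinear_scaleC A_inner_simps
            norm_mult power2_eq_square)
      then have "cmod (A_inner A (T x) x) / (A_norm A x)\<^sup>2 \<in> S"
        unfolding S_def by force
      from upper[OF this] show ?thesis
        using False by (simp add: divide_le_eq order_less_le)
    qed
  qed
  show "A_numerical_radius A T \<le> C"
    if "0 \<le> C \<and> (\<forall>x. cmod (A_inner A (T x) x) \<le> C * (A_norm A x)\<^sup>2)"
    unfolding S using that
    by (intro cSup_least) (auto simp: S_def, metis mult.right_neutral power_one)
qed

lemma
  assumes "A_bounded T"
  shows A_opnorm_nonneg: "0 \<le> A_opnorm A T"
    and A_norm_le_A_opnorm: "A_norm A (T x) \<le> A_opnorm A T * A_norm A x"
  using A_opnorm_le_iff[OF assms, of "A_opnorm A T"] by auto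

lemma
  assumes "A_bounded T"
  shows A_numerical_radius_nonneg: "0 \<le> A_numerical_radius A T"
    and A_inner_le_A_numerical_radius:
      "cmod (A_inner A (T x) x) \<le> A_numerical_radius A T * (A_norm A x)\<^sup>2"
  using A_numerical_radius_le_iff[OF assms, of "A_numerical_radius A T"] by auto

text \<open>For symmetric \<open>R\<close> the cross terms in the quadratic form agree in real part,
  so its values at \<open>x + y\<close> and \<open>x - y\<close> differ by four times the real part
  of \<open>A_inner A (R x) y\<close>. The parallelogram law bounds this difference.\<close>

lemma A_opnorm_symmetric_le:
  assumes R: "A_bounded R" and sym: "\<And>x y. A_inner A (R x) y = A_inner A x (R y)"
    and "0 \<le> C" and le: "\<And>x. cmod (A_inner A (R x) x) \<le> C * (A_norm A x)\<^sup>2"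
  shows "A_opnorm A R \<le> C"
proof -
  have "A_norm A (R x) \<le> C * A_norm A x" for x
  proof (cases "A_norm A (R x) = 0")
    case True
    then show ?thesis using \<open>0 \<le> C\<close> by simp
  next
    case False
    define s r where "s = A_norm A x" and "r = A_norm A (R x)"
    have "0 < r" using False by (simp add: r_def order_less_le)
    \<comment> \<open>If \<open>x\<close> were a null vector, A-boundedness would make
      \<open>R x\<close> one too.\<close>
    have "0 < s"
      using A_norm_le_A_opnorm[OF R, of x] False A_norm_nonneg[of "R x"]
      by (auto simp: s_def order_less_le simp del: A_norm_nonneg intro: A_norm_nonneg)
    \<comment> \<open>Points along \<open>R x\<close> with the seminorm of \<open>x\<close>: the
      pairing becomes \<open>s * r\<close> and the parallelogram sum
      \<open>4 * s\<^sup>2\<close>.\<close>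
    define y where "y = complex_of_real (s / r) *\<^sub>C R x"
    have clinear: "bounded_clinear R" using R by (simp add: A_bounded_def)
    have y: "A_norm A y = s"
      using \<open>0 < r\<close> \<open>0 < s\<close> by (simp add: y_def A_norm_scaleC r_def[symmetric] norm_divide)
    have "A_inner A (R x) y = of_real (s * r)"
      using \<open>0 < r\<close>
      by (simp add: y_def A_inner_simps A_inner_self r_def[symmetric] power2_eq_square)
    moreover have "Re (A_inner A (R y) x) = Re (A_inner A (R x) y)"
      using A_inner_commute[of y "R x"] by (simp add: sym[of y])
    ultimately have "4 * (s * r) =
        Re (A_inner A (R (x + y)) (x + y)) - Re (A_inner A (R (x - y)) (x - y))"
      by (simp add: bounded_clinear_add[OF clinear] bounded_clinear_diff[OF clinear] A_inner_simps)
    also have "\<dots> \<le> cmod (A_inner A (R (x + y)) (x + y)) + cmod (A_inner A (R (x - y)) (x - y))"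
      using abs_Re_le_cmod[of "A_inner A (R (x + y)) (x + y)"]
        abs_Re_le_cmod[of "A_inner A (R (x - y)) (x - y)"] by linarith
    also have "\<dots> \<le> C * ((A_norm A (x + y))\<^sup>2 + (A_norm A (x - y))\<^sup>2)"
      using le[of "x + y"] le[of "x - y"] by (simp add: distrib_left)
    also have "(A_norm A (x + y))\<^sup>2 + (A_norm A (x - y))\<^sup>2 = 2 * (A_norm A x)\<^sup>2 + 2 * (A_norm A y)\<^sup>2"
      by (simp add: A_norm_sq A_inner_simps)
    also have "\<dots> = 4 * s\<^sup>2" by (simp add: y s_def[symmetric])
    finally have "s * r \<le> s * (C * s)" by (simp add: power2_eq_square algebra_simps)
    then show ?thesis using \<open>0 < s\<close> by (simp add: r_def s_def)
  qed
  then show ?thesis using A_opnorm_le_iff[OF R] \<open>0 \<le> C\<close> by blast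
qed

subsection \<open>Real and imaginary parts\<close>

lemma B_A_scaleC:
  assumes "T \<in> B_A A"
  shows "(\<lambda>x. c *\<^sub>C T x) \<in> B_A A"
  unfolding B_A_iff
proof (intro conjI allI)
  show "bounded_clinear (\<lambda>x. c *\<^sub>C T x)"
    using assms by (simp add: B_A_iff bounded_clinear_scaleC_left)
  show "\<exists>z. \<forall>x. A_inner A (c *\<^sub>C T x) y = A_inner A x z" for y
    by (intro exI[of _ "cnj c *\<^sub>C A_adjoint A T y"])
      (simp add: A_inner_simps A_inner_A_adjoint[OF assms])
qed

text \<open>A unimodular factor changes no element of the set under the supremum.\<close>

lemma A_opnorm_rotate: "cmod c = 1 \<Longrightarrow> A_opnorm A (\<lambda>x. c *\<^sub>C T x) = A_opnorm A T"
  by (simp add: A_opnorm_def A_norm_scaleC)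

lemma A_numerical_radius_rotate:
  "cmod c = 1 \<Longrightarrow> A_numerical_radius A (\<lambda>x. c *\<^sub>C T x) = A_numerical_radius A T"
  by (simp add: A_numerical_radius_def A_inner_simps norm_mult)

context
  fixes T
  assumes T: "T \<in> B_A A"
begin

lemma clinear_T: "bounded_clinear T"
  using T by (simp add: B_A_iff)

lemma A_inner_A_adjoint_left: "A_inner A (A_adjoint A T x) y = A_inner A x (T y)"
  by (rule A_inner_adjoint_swap[OF A_inner_A_adjoint[OF T]])

lemma B_A_A_bounded: "A_bounded T"
  by (rule A_adjointable_A_bounded[OF clinear_T clinear_A_adjoint[OF T] A_inner_A_adjoint[OF T]])

lemma A_bounded_A_adjoint: "A_bounded (A_adjoint A T)"
  by (rule A_adjointable_A_bounded[OF clinear_A_adjoint[OF T] clinear_T A_inner_A_adjoint_left])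

lemma A_bounded_A_Re: "A_bounded (A_Re A T)"
  unfolding A_Re_def
  by (intro A_bounded_scaleC A_bounded_add B_A_A_bounded A_bounded_A_adjoint)

lemma A_bounded_A_Im: "A_bounded (A_Im A T)"
proof -
  have "A_bounded (\<lambda>x. (1 / (2 * \<i>)) *\<^sub>C (T x + (- 1) *\<^sub>C A_adjoint A T x))"
    by (intro A_bounded_scaleC A_bounded_add B_A_A_bounded A_bounded_A_adjoint)
  then show ?thesis by (simp add: A_Im_def scaleC_minus_one)
qed

lemma A_inner_A_Re: "A_inner A (A_Re A T x) x = of_real (Re (A_inner A (T x) x))"
  using A_inner_commute[of x "T x"]
  by (simp add: A_Re_def A_inner_simps A_inner_A_adjoint_left complex_eq_iff)

lemma A_inner_A_Im: "A_inner A (A_Im A T x) x = of_real (Im (A_inner A (T x) x))"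
  using A_inner_commute[of x "T x"]
  by (simp add: A_Im_def A_inner_simps A_inner_A_adjoint_left complex_eq_iff Re_divide Im_divide)

lemma A_opnorm_A_Re_le: "A_opnorm A (A_Re A T) \<le> A_numerical_radius A T"
proof (rule A_opnorm_symmetric_le[OF A_bounded_A_Re])
  show "A_inner A (A_Re A T x) y = A_inner A x (A_Re A T y)" for x y
    by (simp add: A_Re_def A_inner_simps A_inner_A_adjoint_left A_inner_A_adjoint[OF T])
  show "cmod (A_inner A (A_Re A T x) x) \<le> A_numerical_radius A T * (A_norm A x)\<^sup>2" for x
    using order_trans[OF abs_Re_le_cmod A_inner_le_A_numerical_radius[OF B_A_A_bounded]]
    by (simp add: A_inner_A_Re)
qed (rule A_numerical_radius_nonneg[OF B_A_A_bounded])

lemma A_opnorm_A_Im_le: "A_opnorm A (A_Im A T) \<le> A_numerical_radius A T"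
proof (rule A_opnorm_symmetric_le[OF A_bounded_A_Im])
  show "A_inner A (A_Im A T x) y = A_inner A x (A_Im A T y)" for x y
    by (simp add: A_Im_def A_inner_simps A_inner_A_adjoint_left A_inner_A_adjoint[OF T] field_simps)
  show "cmod (A_inner A (A_Im A T x) x) \<le> A_numerical_radius A T * (A_norm A x)\<^sup>2" for x
    using order_trans[OF abs_Im_le_cmod A_inner_le_A_numerical_radius[OF B_A_A_bounded]]
    by (simp add: A_inner_A_Im)
qed (rule A_numerical_radius_nonneg[OF B_A_A_bounded])

lemma A_Re_plus_A_Im: "A_Re A T x + \<i> *\<^sub>C A_Im A T x = T x"
proof -
  have "A_Re A T x + \<i> *\<^sub>C A_Im A T x = (1 / 2 + 1 / 2 :: complex) *\<^sub>C T x"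
    unfolding scaleC_add_left
    by (simp add: A_Re_def A_Im_def scaleC_scaleC scaleC_add_right scaleC_diff_right)
  then show ?thesis by simp
qed

lemma A_opnorm_le_A_Re_A_Im: "A_opnorm A T \<le> A_opnorm A (A_Re A T) + A_opnorm A (A_Im A T)"
  unfolding A_opnorm_le_iff[OF B_A_A_bounded]
proof (intro conjI allI)
  show "0 \<le> A_opnorm A (A_Re A T) + A_opnorm A (A_Im A T)"
    by (simp add: A_opnorm_nonneg A_bounded_A_Re A_bounded_A_Im)
  fix x
  have "A_norm A (T x) \<le> A_norm A (A_Re A T x) + A_norm A (A_Im A T x)"
    using A_norm_add_le[of "A_Re A T x" "\<i> *\<^sub>C A_Im A T x"]
    by (simp add: A_Re_plus_A_Im A_norm_scaleC)
  then show "A_norm A (T x) \<le> (A_opnorm A (A_Re A T) + A_opnorm A (A_Im A T)) * A_norm A x"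
    using A_norm_le_A_opnorm[OF A_bounded_A_Re, of x] A_norm_le_A_opnorm[OF A_bounded_A_Im, of x]
    by (simp add: distrib_right)
qed

lemma A_opnorm_A_Re_A_Im_eq:
  assumes "A_numerical_radius A T = A_opnorm A T / 2"
  shows "A_opnorm A (A_Re A T) = A_opnorm A T / 2" "A_opnorm A (A_Im A T) = A_opnorm A T / 2"
  using A_opnorm_A_Re_le A_opnorm_A_Im_le A_opnorm_le_A_Re_A_Im assms by linarith+

end

text \<open>The angle may depend on the vector, so each value of the quadratic form can be rotated
  to be its own real part.\<close>

lemma A_numerical_radius_eq_if_A_Re_eq:
  assumes T: "T \<in> B_A A"
    and eq: "\<And>\<theta>. A_opnorm A (A_Re A (\<lambda>x. exp (\<i> * complex_of_real \<theta>) *\<^sub>C T x)) = C"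
  shows "A_numerical_radius A T = C"
proof (rule antisym)
  define U where "U \<theta> = (\<lambda>x. exp (\<i> * complex_of_real \<theta>) *\<^sub>C T x)" for \<theta>
  have U: "U \<theta> \<in> B_A A" for \<theta> unfolding U_def by (rule B_A_scaleC[OF T])
  have eq: "A_opnorm A (A_Re A (U \<theta>)) = C" for \<theta> using eq by (simp add: U_def)
  \<comment> \<open>At angle \<open>0\<close> the rotated operator is \<open>T\<close>
    itself.\<close>
  show "C \<le> A_numerical_radius A T"
    using A_opnorm_A_Re_le[OF U[of 0]] eq[of 0] by (simp add: U_def)
  have "0 \<le> C" using A_opnorm_nonneg[OF A_bounded_A_Re[OF U]] eq by metis
  moreover have "cmod (A_inner A (T x) x) \<le> C * (A_norm A x)\<^sup>2" for x
  proof -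
    \<comment> \<open>Cancels the argument, turning \<open>A_inner A (T x) x\<close> into its
      modulus.\<close>
    define \<theta> where "\<theta> = - Arg (A_inner A (T x) x)"
    have "A_inner A (U \<theta> x) x = of_real (cmod (A_inner A (T x) x))"
    proof -
      have "A_inner A (T x) x = of_real (cmod (A_inner A (T x) x)) * exp (\<i> * of_real (- \<theta>))"
        using rcis_cmod_Arg[of "A_inner A (T x) x"] by (simp add: \<theta>_def rcis_def cis_conv_exp)
      then have "exp (\<i> * of_real \<theta>) * A_inner A (T x) x
          = of_real (cmod (A_inner A (T x) x)) * (exp (\<i> * of_real (- \<theta>)) * exp (\<i> * of_real \<theta>))"
        by (metis mult.assoc mult.commute)
      then show ?thesis by (simp add: U_def A_inner_simps flip: exp_add)
    qed
    then have "cmod (A_inner A (T x) x) = cmod (A_inner A (A_Re A (U \<theta>) x) x)"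
      by (simp add: A_inner_A_Re[OF U])
    also have "\<dots> \<le> A_norm A (A_Re A (U \<theta>) x) * A_norm A x"
      by (rule A_inner_Cauchy_Schwarz)
    also have "\<dots> \<le> C * A_norm A x * A_norm A x"
      using A_norm_le_A_opnorm[OF A_bounded_A_Re[OF U]] eq by (intro mult_right_mono) auto
    finally show ?thesis by (simp add: power2_eq_square mult.assoc)
  qed
  ultimately show "A_numerical_radius A T \<le> C"
    using A_numerical_radius_le_iff[OF B_A_A_bounded[OF T]] by blast
qed

theorem A_numerical_radius_eq_half_A_opnorm_iff:
  assumes T: "T \<in> B_A A"
  shows "A_numerical_radius A T = A_opnorm A T / 2 \<longleftrightarrow>
    (\<forall>\<theta>::real.
      A_opnorm A (A_Re A (\<lambda>x. exp (\<i> * complex_of_real \<theta>) *\<^sub>C T x)) = A_opnorm A T / 2 \<and>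
      A_opnorm A (A_Im A (\<lambda>x. exp (\<i> * complex_of_real \<theta>) *\<^sub>C T x)) = A_opnorm A T / 2)"
    (is "?L \<longleftrightarrow> (\<forall>\<theta>. ?R \<theta>)")
proof
  assume L: ?L
  show "\<forall>\<theta>. ?R \<theta>"
  proof
    fix \<theta> :: real
    show "?R \<theta>"
      using A_opnorm_A_Re_A_Im_eq[OF B_A_scaleC[OF T, of "exp (\<i> * complex_of_real \<theta>)"]] L
      by (simp add: A_opnorm_rotate A_numerical_radius_rotate)
  qed
next
  assume "\<forall>\<theta>. ?R \<theta>"
  then show ?L by (intro A_numerical_radius_eq_if_A_Re_eq[OF T]) blast
qed

end

subsection \<open>A matrix violating the converse\<close>

text \<open>
  The matrix is the direct sum of \<open>((0, 2), (0, 0))\<close>, whose real and imaginary parts are unitary,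
  and the scalar \<open>1 + \<i>\<close>, whose real and imaginary parts are \<open>1\<close> but whose modulus exceeds \<open>1\<close>.
\<close>

definition shift_sum :: "complex ^ 3 \<Rightarrow> complex ^ 3"
  where "shift_sum x = (\<chi> i. if i = 1 then 2 * x $ 2 else if i = 2 then 0 else (1 + \<i>) * x $ 3)"

text \<open>The conjugate transpose of \<open>shift_sum\<close>.\<close>

definition shift_sum_adj :: "complex ^ 3 \<Rightarrow> complex ^ 3"
  where "shift_sum_adj x = (\<chi> i. if i = 1 then 0 else if i = 2 then 2 * x $ 1 else (1 - \<i>) * x $ 3)"

lemma norm_vec3_sq: "(norm x)\<^sup>2 = (cmod (x $ 1))\<^sup>2 + (cmod (x $ 2))\<^sup>2 + (cmod (x $ 3))\<^sup>2"
  for x :: "complex ^ 3"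
  by (simp add: norm_vec_def L2_set_def sum_3)

lemma cmod_one_plus_ii_sq: "(cmod (1 + \<i>))\<^sup>2 = 2" "(cmod (1 - \<i>))\<^sup>2 = 2"
  by (simp_all add: cmod_power2)

lemma norm_shift_sum_le: "norm (shift_sum x) \<le> 2 * norm x"
  by (rule power2_le_imp_le)
    (simp_all add: norm_vec3_sq shift_sum_def norm_mult power_mult_distrib cmod_one_plus_ii_sq)

lemma norm_shift_sum_adj_le: "norm (shift_sum_adj x) \<le> 2 * norm x"
  by (rule power2_le_imp_le)
    (simp_all add: norm_vec3_sq shift_sum_adj_def norm_mult power_mult_distrib cmod_one_plus_ii_sq)

lemma clinear_shift_sum: "bounded_clinear shift_sum"
  by (rule bounded_clinearI[OF _ _ norm_shift_sum_le])
    (simp_all add: vec_eq_iff shift_sum_def scaleC_vec_def scaleC_complex_def algebra_simps)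

lemma clinear_shift_sum_adj: "bounded_clinear shift_sum_adj"
  by (rule bounded_clinearI[OF _ _ norm_shift_sum_adj_le])
    (simp_all add: vec_eq_iff shift_sum_adj_def scaleC_vec_def scaleC_complex_def algebra_simps)

lemma shift_sum_adjoint:
  "A_inner (\<lambda>x. x) (shift_sum x) y = A_inner (\<lambda>x. x) x (shift_sum_adj y)"
  by (simp add: A_inner_def cinner_vec_def cinner_complex_def sum_3 shift_sum_def shift_sum_adj_def)

interpretation id3: positive_operator "\<lambda>x::complex ^ 3. x"
  by standard (rule positive_op_id)

lemma shift_sum_in_B_A: "shift_sum \<in> B_A (\<lambda>x. x)"
  unfolding id3.B_A_iff using clinear_shift_sum shift_sum_adjoint by blast

lemma A_adjoint_shift_sum: "A_adjoint (\<lambda>x. x) shift_sum = shift_sum_adj"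
  by (rule id3.A_adjoint_eqI[OF clinear_shift_sum clinear_shift_sum_adj _ shift_sum_adjoint]) simp

text \<open>Pins the seminorm between a global bound and one nonzero vector attaining it.\<close>

lemma id3_opnorm_eqI:
  assumes T: "id3.A_bounded T" and "\<And>x. norm (T x) \<le> C * norm x"
    and "C * norm x \<le> norm (T x)" "x \<noteq> 0" "0 \<le> C"
  shows "A_opnorm (\<lambda>x. x) T = C"
proof (rule antisym)
  show "A_opnorm (\<lambda>x. x) T \<le> C" using assms by (simp add: id3.A_opnorm_le_iff)
  have "C * norm x \<le> A_opnorm (\<lambda>x. x) T * norm x"
    using id3.A_norm_le_A_opnorm[OF T, of x] assms(3) by simp
  then show "C \<le> A_opnorm (\<lambda>x. x) T" using \<open>x \<noteq> 0\<close> by simp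
qed

lemma A_opnorm_shift_sum: "A_opnorm (\<lambda>x. x) shift_sum = 2"
proof (rule id3_opnorm_eqI[OF id3.B_A_A_bounded[OF shift_sum_in_B_A] norm_shift_sum_le])
  \<comment> \<open>The second basis vector is sent to twice the first.\<close>
  show "2 * norm (axis 2 1 :: complex ^ 3) \<le> norm (shift_sum (axis 2 1))"
    by (rule power2_le_imp_le) (simp_all add: norm_vec3_sq shift_sum_def axis_def power_mult_distrib)
qed (simp_all add: axis_eq_0_iff)

text \<open>The real part only swaps the first two coordinates.\<close>

lemma norm_A_Re_shift_sum: "norm (A_Re (\<lambda>x. x) shift_sum x) = norm x"
  unfolding power2_eq_iff_nonneg[OF norm_ge_zero norm_ge_zero, symmetric] A_Re_def A_adjoint_shift_sum
  by (simp add: norm_vec3_sq shift_sum_def shift_sum_adj_def scaleC_vec_def scaleC_complex_def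
      norm_mult norm_divide algebra_simps add_divide_distrib diff_divide_distrib)

text \<open>The imaginary part sends \<open>(x1, x2, x3)\<close> to
  \<open>(- \<i> x2, \<i> x1, x3)\<close>.\<close>

lemma norm_A_Im_shift_sum: "norm (A_Im (\<lambda>x. x) shift_sum x) = norm x"
  unfolding power2_eq_iff_nonneg[OF norm_ge_zero norm_ge_zero, symmetric] A_Im_def A_adjoint_shift_sum
  by (simp add: norm_vec3_sq shift_sum_def shift_sum_adj_def scaleC_vec_def scaleC_complex_def
      norm_mult norm_divide algebra_simps add_divide_distrib diff_divide_distrib)

lemma A_opnorm_A_Re_shift_sum: "A_opnorm (\<lambda>x. x) (A_Re (\<lambda>x. x) shift_sum) = 1"
  by (rule id3_opnorm_eqI[OF id3.A_bounded_A_Re[OF shift_sum_in_B_A], where x = "axis 3 1"])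
    (simp_all add: norm_A_Re_shift_sum axis_eq_0_iff)

lemma A_opnorm_A_Im_shift_sum: "A_opnorm (\<lambda>x. x) (A_Im (\<lambda>x. x) shift_sum) = 1"
  by (rule id3_opnorm_eqI[OF id3.A_bounded_A_Im[OF shift_sum_in_B_A], where x = "axis 3 1"])
    (simp_all add: norm_A_Im_shift_sum axis_eq_0_iff)

text \<open>The third basis vector is a unit eigenvector with eigenvalue \<open>1 + \<i>\<close>, of
  modulus above \<open>1\<close>, which is half the seminorm of \<open>shift_sum\<close>.\<close>

lemma A_numerical_radius_shift_sum: "A_numerical_radius (\<lambda>x. x) shift_sum \<noteq> 1"
proof
  assume "A_numerical_radius (\<lambda>x. x) shift_sum = 1"
  then have "cmod (A_inner (\<lambda>x. x) (shift_sum (axis 3 1)) (axis 3 1)) \<le> (norm (axis 3 1 :: complex ^ 3))\<^sup>2"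
    using id3.A_inner_le_A_numerical_radius[OF id3.B_A_A_bounded[OF shift_sum_in_B_A], of "axis 3 1"]
    by simp
  then have "cmod (1 + \<i>) \<le> 1"
    by (simp add: norm_vec3_sq A_inner_def cinner_vec_def cinner_complex_def sum_3 shift_sum_def axis_def)
  then have "(cmod (1 + \<i>))\<^sup>2 \<le> 1\<^sup>2" by (intro power_mono) auto
  then show False by (simp add: cmod_one_plus_ii_sq)
qed

theorem theorem2p3:
  shows "(\<forall>(A :: 'a::chilbert_space \<Rightarrow> 'a) T. positive_op A \<longrightarrow> T \<in> B_A A \<longrightarrow>
            A_numerical_radius A T = A_opnorm A T / 2 \<longrightarrow>
            A_opnorm A (A_Re A T) = A_opnorm A T / 2 \<and>
            A_opnorm A (A_Im A T) = A_opnorm A T / 2) \<and>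
         (\<exists>(A :: complex ^ 3 \<Rightarrow> complex ^ 3) T. positive_op A \<and> T \<in> B_A A \<and>
            A_opnorm A (A_Re A T) = A_opnorm A T / 2 \<and>
            A_opnorm A (A_Im A T) = A_opnorm A T / 2 \<and>
            A_numerical_radius A T \<noteq> A_opnorm A T / 2) \<and>
         (\<forall>(A :: 'a \<Rightarrow> 'a) T. positive_op A \<longrightarrow> T \<in> B_A A \<longrightarrow>
            (A_numerical_radius A T = A_opnorm A T / 2 \<longleftrightarrow>
             (\<forall>\<theta>::real.
                A_opnorm A (A_Re A (\<lambda>x. exp (\<i> * complex_of_real \<theta>) *\<^sub>C T x)) = A_opnorm A T / 2 \<and>
                A_opnorm A (A_Im A (\<lambda>x. exp (\<i> * complex_of_real \<theta>) *\<^sub>C T x)) = A_opnorm A T / 2)))"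
proof (intro conjI allI impI)
  show "\<exists>(A :: complex ^ 3 \<Rightarrow> complex ^ 3) T. positive_op A \<and> T \<in> B_A A \<and>
            A_opnorm A (A_Re A T) = A_opnorm A T / 2 \<and>
            A_opnorm A (A_Im A T) = A_opnorm A T / 2 \<and>
            A_numerical_radius A T \<noteq> A_opnorm A T / 2"
    by (rule exI[of _ "\<lambda>x. x"], rule exI[of _ shift_sum])
      (simp add: positive_op_id shift_sum_in_B_A A_opnorm_shift_sum A_opnorm_A_Re_shift_sum
        A_opnorm_A_Im_shift_sum A_numerical_radius_shift_sum)
next
  fix A T :: "'a \<Rightarrow> 'a"
  assume A: "positive_op A" and T: "T \<in> B_A A"
  interpret positive_operator A by (rule positive_operator.intro[OF A])
  show "A_numerical_radius A T = A_opnorm A T / 2 \<longleftrightarrow>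
      (\<forall>\<theta>::real.
        A_opnorm A (A_Re A (\<lambda>x. exp (\<i> * complex_of_real \<theta>) *\<^sub>C T x)) = A_opnorm A T / 2 \<and>
        A_opnorm A (A_Im A (\<lambda>x. exp (\<i> * complex_of_real \<theta>) *\<^sub>C T x)) = A_opnorm A T / 2)"
    by (rule A_numerical_radius_eq_half_A_opnorm_iff[OF T])
\<comment> \<open>What remains are the two equalities of the first claim.\<close>
qed (blast intro: positive_operator.intro positive_operator.A_opnorm_A_Re_A_Im_eq)+

end
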